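(* Let $G$ be a profinite group of type (F) and let $\phi$ be a continuous endomorphism of $G$. Then $\mathrm{Con}(\phi)$ and $\phi_+(G)$ are both closed subgroups of $G$, and $G = \mathrm{Con}(\phi) \rtimes \phi_+(G)$ (internal semidirect product, with $\mathrm{Con}(\phi)$ the normal factor). The restriction of $\phi$ to $\phi_+(G)$ is an automorphism of $\phi_+(G)$, and $\phi^k(\mathrm{Con}(\phi)) = \mathrm{Con}(\phi) \cap \phi^k(G)$ for all integers $k \ge 0$.
   Context: All homomorphisms between profinite groups are understood to be continuous. A profinite group $G$ is of type (F) if for every positive integer $n$ it has only finitely many open subgroups of index $n$. For an endomorphism $\phi$ of $G$, define $$\mathrm{Con}(\phi) = \{x \in G \mid \lim_{n\to+\infty} \phi^n(x) = 1\}, \qquad \phi_+(G) = \bigcap_{n \ge 0} \phi^n(G).$$ *)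

theory Defs
  imports "HOL-Analysis.Analysis" "HOL-Algebra.Coset"
begin

locale topological_group = group G for G (structure) +
  fixes T :: "'a topology"
  assumes topspace_carrier: "topspace T = carrier G"
    and continuous_mult: "continuous_map (prod_topology T T) T (\<lambda>(x, y). x \<otimes> y)"
    and continuous_inv: "continuous_map T T (\<lambda>x. inv x)"

definition totally_disconnected_space :: "'a topology \<Rightarrow> bool" where
  "totally_disconnected_space T \<longleftrightarrow> (\<forall>x \<in> topspace T. connected_component_of_set T x = {x})"

locale profinite_group = topological_group +
  assumes compact: "compact_space T"
    and Hausdorff: "Hausdorff_space T"
    and totally_disconnected: "totally_disconnected_space T"

text \<open>Since \<open>n > 0\<close>, the condition \<open>card (rcosets H) = n\<close> also says that the index is finite.\<close>

definition type_F :: "('a, 'b) monoid_scheme \<Rightarrow> 'a topology \<Rightarrow> bool" where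
  "type_F G T \<longleftrightarrow>
     (\<forall>n::nat. n > 0 \<longrightarrow>
        finite {H. subgroup H G \<and> openin T H \<and> card (rcosets\<^bsub>G\<^esub> H) = n})"

definition continuous_endomorphism ::
    "('a, 'b) monoid_scheme \<Rightarrow> 'a topology \<Rightarrow> ('a \<Rightarrow> 'a) \<Rightarrow> bool" where
  "continuous_endomorphism G T \<phi> \<longleftrightarrow> \<phi> \<in> hom G G \<and> continuous_map T T \<phi>"

definition Con :: "('a, 'b) monoid_scheme \<Rightarrow> 'a topology \<Rightarrow> ('a \<Rightarrow> 'a) \<Rightarrow> 'a set" where
  "Con G T \<phi> = {x \<in> carrier G. limitin T (\<lambda>n. (\<phi> ^^ n) x) \<one>\<^bsub>G\<^esub> sequentially}"

definition phi_plus :: "('a, 'b) monoid_scheme \<Rightarrow> ('a \<Rightarrow> 'a) \<Rightarrow> 'a set" where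
  "phi_plus G \<phi> = (\<Inter>n::nat. (\<phi> ^^ n) ` carrier G)"

definition internal_semidirect_product ::
    "('a, 'b) monoid_scheme \<Rightarrow> 'a set \<Rightarrow> 'a set \<Rightarrow> bool" where
  "internal_semidirect_product G N H \<longleftrightarrow>
     N \<lhd> G \<and> subgroup H G \<and> N \<inter> H = {\<one>\<^bsub>G\<^esub>} \<and> N <#>\<^bsub>G\<^esub> H = carrier G"

text \<open>Automorphisms of a subgroup are meant in the category of topological groups, the subgroup
  carrying the subspace topology: group automorphisms that are also homeomorphisms.\<close>

definition restricts_to_automorphism ::
    "('a, 'b) monoid_scheme \<Rightarrow> 'a topology \<Rightarrow> ('a \<Rightarrow> 'a) \<Rightarrow> 'a set \<Rightarrow> bool" where
  "restricts_to_automorphism G T \<phi> H \<longleftrightarrow>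
     \<phi> \<in> iso (G\<lparr>carrier := H\<rparr>) (G\<lparr>carrier := H\<rparr>) \<and>
     homeomorphic_map (subtopology T H) (subtopology T H) \<phi>"

end

theory Submission
  imports Defs
begin

text \<open>
  A continuous endomorphism pulls an open subgroup of index at most \<open>n\<close> back to one of index at
  most \<open>n\<close>. Hence the intersections \<open>M n\<close> (below: \<open>open_core n\<close>) of all open subgroups of index at
  most \<open>n\<close>, which are open by type (F) and form a base of neighbourhoods of the identity, are
  invariant under every continuous endomorphism, in particular under \<open>\<phi>\<close> and under conjugation.
  So \<open>Con(\<phi>)\<close> is the intersection of the open normal subgroups \<open>B n = {x. \<exists>k. \<phi>^k(x) \<in> M n}\<close>
  (below: \<open>basin n\<close>). Since the preimage of \<open>B n\<close> is \<open>B n\<close> itself, \<open>\<phi>\<close> acts injectively on the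
  finite set of cosets of \<open>B n\<close>, so each \<open>g\<close> is congruent modulo \<open>B n\<close> to \<open>\<phi>^p(g)\<close> for arbitrarily
  large \<open>p\<close>, and by compactness \<open>g\<close> is congruent to an element of \<open>\<phi>_+(G)\<close> modulo \<open>Con(\<phi>)\<close>.
  Conversely, the backward orbit of a point \<open>x\<close> of \<open>\<phi>_+(G)\<close> returns modulo \<open>M n\<close>, so \<open>x\<close> is
  congruent modulo \<open>M n\<close> to \<open>\<phi>^p(x)\<close> for arbitrarily large \<open>p\<close>; if also \<open>x \<in> Con(\<phi>)\<close>, then
  \<open>x \<in> M n\<close> for all \<open>n\<close> and \<open>x\<close> is trivial.
\<close>

section \<open>Open subgroups of topological groups\<close>

context topological_group
begin

lemma continuous_mult_compose:
  assumes "continuous_map X T f" and "continuous_map X T g"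
  shows "continuous_map X T (\<lambda>x. f x \<otimes> g x)"
proof -
  have "continuous_map X (prod_topology T T) (\<lambda>x. (f x, g x))"
    using assms by (simp add: continuous_map_pairwise o_def)
  from continuous_map_compose[OF this continuous_mult] show ?thesis
    by (simp add: o_def)
qed

lemma continuous_conj:
  assumes "g \<in> carrier G"
  shows "continuous_map T T (\<lambda>x. g \<otimes> x \<otimes> inv g)"
  using assms by (intro continuous_mult_compose) (auto simp: topspace_carrier)

lemma openin_r_coset:
  assumes H: "subgroup H G" "openin T H" and a: "a \<in> carrier G"
  shows "openin T (H #> a)"
proof -
  have "continuous_map T T (\<lambda>x. x \<otimes> inv a)"
    using a by (intro continuous_mult_compose) (auto simp: topspace_carrier)
  then have "openin T {x \<in> topspace T. x \<otimes> inv a \<in> H}"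
    using H(2) by (rule openin_continuous_map_preimage)
  moreover have "{x \<in> topspace T. x \<otimes> inv a \<in> H} = H #> a"
    using subgroup.rcos_module[OF H(1) is_group a] r_coset_subset_G[OF subgroup.subset[OF H(1)] a]
    by (auto simp: topspace_carrier)
  ultimately show ?thesis by simp
qed

text \<open>The complement is the union of the cosets of elements outside \<open>H\<close>, and each
  of these cosets is open.\<close>

lemma open_subgroup_closedin:
  assumes H: "subgroup H G" "openin T H"
  shows "closedin T H"
proof -
  have "topspace T - H = (\<Union>a\<in>carrier G - H. H #> a)"
  proof (intro equalityI subsetI)
    fix x assume "x \<in> topspace T - H"
    then show "x \<in> (\<Union>a\<in>carrier G - H. H #> a)"
      using rcos_self[OF _ H(1)] by (auto simp: topspace_carrier)
  next
    fix x assume "x \<in> (\<Union>a\<in>carrier G - H. H #> a)"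
    then obtain a h where ah: "a \<in> carrier G" "a \<notin> H" "h \<in> H" "x = h \<otimes> a"
      by (auto simp: r_coset_def)
    have hc: "h \<in> carrier G" using ah H(1) subgroup.mem_carrier by metis
    have "a = inv h \<otimes> (h \<otimes> a)" using ah hc by (simp add: m_assoc[symmetric])
    then have "x \<notin> H"
      using ah H(1) by (metis subgroup.m_closed subgroup.m_inv_closed)
    then show "x \<in> topspace T - H" using ah hc by (simp add: topspace_carrier)
  qed
  moreover have "openin T (\<Union>a\<in>carrier G - H. H #> a)"
    using openin_r_coset[OF H] by auto
  ultimately show ?thesis
    using openin_subset[OF H(2)] by (simp add: closedin_def)
qed

text \<open>The cosets are an open cover by pairwise disjoint nonempty sets, so a finite subcover
  must contain every one of them.\<close>

lemma finite_rcosets_open: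
  assumes "compact_space T" and H: "subgroup H G" "openin T H"
  shows "finite (rcosets H)"
proof -
  have "\<And>K. K \<in> rcosets H \<Longrightarrow> openin T K"
    using openin_r_coset[OF H] by (auto simp: RCOSETS_def)
  moreover have "topspace T \<subseteq> \<Union>(rcosets H)"
    using rcosets_part_G[OF H(1)] by (simp add: topspace_carrier)
  ultimately obtain F where F: "finite F" "F \<subseteq> rcosets H" "topspace T \<subseteq> \<Union>F"
    using assms(1) unfolding compact_space_alt by metis
  have "rcosets H \<subseteq> F"
  proof
    fix K assume K: "K \<in> rcosets H"
    then obtain a where a: "a \<in> carrier G" "K = H #> a" by (auto simp: RCOSETS_def)
    then have "a \<in> K" using rcos_self H(1) by blast
    moreover obtain L where "L \<in> F" "a \<in> L" using F(3) a by (auto simp: topspace_carrier)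
    ultimately show "K \<in> F"
      using rcos_disjoint[OF H(1)] K F(2) by (metis disjnt_iff pairwiseD subsetD)
  qed
  then show ?thesis using F(1) finite_subset by blast
qed

text \<open>Pigeonhole on the finitely many cosets of \<open>H\<close>. It serves both for backward
  iterates of a point of \<phi>_+(G) and for forward orbits.\<close>

lemma open_subgroup_recurrence:
  fixes f :: "nat \<Rightarrow> 'a"
  assumes "compact_space T" and H: "subgroup H G" "openin T H"
    and f: "\<And>i. f i \<in> carrier G"
  obtains i j where "i < j" "f i \<otimes> inv (f j) \<in> H"
proof -
  have "range (\<lambda>i. H #> f i) \<subseteq> rcosets H"
    using f subgroup.subset[OF H(1)] by (auto intro: rcosetsI)
  then have "finite (range (\<lambda>i. H #> f i))"
    using finite_rcosets_open[OF assms(1) H] finite_subset by blast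
  then have "\<not> inj (\<lambda>i. H #> f i)"
    using finite_imageD infinite_UNIV_nat by blast
  then obtain i j where "i < j" and eq: "H #> f i = H #> f j"
    by (metis (mono_tags, lifting) injI linorder_neqE_nat)
  moreover have "f i \<otimes> inv (f j) \<in> H"
    using rcos_self[OF f H(1)] eq subgroup.rcos_module_imp[OF H(1) is_group f] by metis
  ultimately show ?thesis using that by blast
qed

lemma subgroup_vimage:
  assumes "subgroup H G" and "h \<in> hom G G"
  shows "subgroup {x \<in> carrier G. h x \<in> H} G"
proof -
  interpret h: group_hom G G h
    by unfold_locales (rule assms(2))
  show ?thesis
    using assms(1) by (intro subgroupI) (auto simp: subgroup.m_closed subgroup.m_inv_closed
        subgroup.one_closed intro!: exI[of _ \<one>])
qed

text \<open>Each coset of the preimage is itself the preimage of a coset of \<open>H\<close>.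
  Compactness makes \<open>rcosets H\<close> finite, so that the cardinalities can be
  compared.\<close>

lemma card_rcosets_vimage_le:
  assumes "compact_space T" and H: "subgroup H G" "openin T H" and h: "h \<in> hom G G"
  shows "card (rcosets {x \<in> carrier G. h x \<in> H}) \<le> card (rcosets H)"
proof -
  let ?P = "{x \<in> carrier G. h x \<in> H}"
  interpret h: group_hom G G h
    by unfold_locales (rule h)
  have P: "subgroup ?P G" using H(1) h by (rule subgroup_vimage)
  have "rcosets ?P \<subseteq> (\<lambda>K. {x \<in> carrier G. h x \<in> K}) ` (rcosets H)"
  proof
    fix K assume "K \<in> rcosets ?P"
    then obtain a where a: "a \<in> carrier G" "K = ?P #> a" by (auto simp: RCOSETS_def)
    have "K = {x \<in> carrier G. h x \<in> H #> h a}"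
      using a subgroup.rcos_module[OF P is_group a(1)] r_coset_subset_G[of ?P a]
        subgroup.rcos_module[OF H(1) is_group, of "h a"]
      by auto
    moreover have "H #> h a \<in> rcosets H"
      using a subgroup.subset[OF H(1)] by (simp add: rcosetsI)
    ultimately show "K \<in> (\<lambda>K. {x \<in> carrier G. h x \<in> K}) ` (rcosets H)" by blast
  qed
  then show ?thesis
    using finite_rcosets_open[OF assms(1) H] surj_card_le by blast
qed

text \<open>The right multipliers mapping \<open>U\<close> into itself form an open set
  \<open>V\<close> closed under products. Keeping those whose inverse is also in \<open>V\<close>
  gives a group, and applying its elements to \<open>\<one> \<in> U\<close> shows that it lies in
  \<open>U\<close>.\<close>

lemma open_subgroup_in_clopen:
  assumes cpt: "compact_space T" and U: "openin T U" "closedin T U" "\<one> \<in> U"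
  obtains H where "subgroup H G" "openin T H" "H \<subseteq> U"
proof -
  have Usub: "U \<subseteq> carrier G" using openin_subset[OF U(1)] by (simp add: topspace_carrier)
  define V where "V = {h \<in> carrier G. \<forall>u\<in>U. u \<otimes> h \<in> U}"
  define H where "H = {h \<in> V. inv h \<in> V}"
  have "openin T V"
  proof -
    \<comment> \<open>The complement of \<open>V\<close> is the projection of the closed set of
      pairs \<open>(u, h)\<close> with \<open>u\<close> in \<open>U\<close> and
      \<open>u \<otimes> h\<close> outside \<open>U\<close>. Projecting along a compact factor is a
      closed map.\<close>
    have "closedin (prod_topology T T)
        {z \<in> topspace (prod_topology T T). (\<lambda>(x, y). x \<otimes> y) z \<in> topspace T - U}"
      using U(1) by (intro closedin_continuous_map_preimage[OF continuous_mult]) auto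
    moreover have "closedin (prod_topology T T) (U \<times> topspace T)"
      using U(2) by (simp add: closedin_prod_Times_iff)
    ultimately have "closedin T (snd ` ((U \<times> topspace T) \<inter>
        {z \<in> topspace (prod_topology T T). (\<lambda>(x, y). x \<otimes> y) z \<in> topspace T - U}))"
      using closed_map_snd[OF cpt, of T] unfolding closed_map_def by blast
    moreover have "(U \<times> topspace T) \<inter>
        {z \<in> topspace (prod_topology T T). (\<lambda>(x, y). x \<otimes> y) z \<in> topspace T - U} =
        (SIGMA u : U. {h \<in> carrier G. u \<otimes> h \<notin> U})"
      using Usub by (auto simp: topspace_carrier)
    moreover have "snd ` (SIGMA u : U. {h \<in> carrier G. u \<otimes> h \<notin> U}) = topspace T - V"
      by (force simp: V_def topspace_carrier)
    ultimately have "closedin T (topspace T - V)" by simp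
    then show ?thesis
      by (simp add: openin_closedin_eq V_def topspace_carrier)
  qed
  moreover have "H = V \<inter> {x \<in> topspace T. inv x \<in> V}"
    by (auto simp: H_def V_def topspace_carrier)
  ultimately have "openin T H"
    using openin_continuous_map_preimage[OF continuous_inv] by (metis openin_Int)
  moreover have "subgroup H G"
  proof (rule subgroupI)
    show "H \<subseteq> carrier G" by (auto simp: H_def V_def)
    show "H \<noteq> {}" using Usub by (auto simp: H_def V_def intro!: exI[of _ \<one>])
    show "inv a \<in> H" if "a \<in> H" for a using that by (auto simp: H_def V_def)
    have V_mult: "a \<otimes> b \<in> V" if "a \<in> V" "b \<in> V" for a b
      using that Usub by (auto simp: V_def m_assoc[symmetric] subset_iff)
    show "a \<otimes> b \<in> H" if "a \<in> H" "b \<in> H" for a b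
    proof -
      have "inv (a \<otimes> b) = inv b \<otimes> inv a"
        using that by (simp add: H_def V_def inv_mult_group)
      then show ?thesis using that V_mult by (simp add: H_def)
    qed
  qed
  moreover have "H \<subseteq> U"
    using U(3) by (fastforce simp: H_def V_def)
  ultimately show ?thesis using that by blast
qed

end

section \<open>Neighbourhood bases of open subgroups and the open cores\<close>

context profinite_group
begin

text \<open>In a compact Hausdorff space the component \<open>{\<one>}\<close> has a clopen
  neighbourhood inside \<open>W\<close>, to which \<open>open_subgroup_in_clopen\<close>
  applies.\<close>

lemma open_subgroup_in_nbhd:
  assumes W: "openin T W" "\<one> \<in> W"
  obtains H where "subgroup H G" "openin T H" "H \<subseteq> W"
proof -
  have one: "\<one> \<in> topspace T" by (simp add: topspace_carrier)
  then have "{\<one>} \<in> connected_components_of T"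
    using totally_disconnected
    by (auto simp: totally_disconnected_space_def connected_components_of_def image_iff)
  then obtain U V where "openin T U" "openin T V" "disjnt U V" "U \<union> V = topspace T"
      and U: "{\<one>} \<subseteq> U" "U \<subseteq> W"
    using wilder_locally_compact_component_thm[of T "{\<one>}" W] W one compact Hausdorff
      compact_imp_locally_compact_space by (metis compactin_sing empty_subsetI insert_subset)
  moreover from this have "topspace T - U = V" by (auto simp: disjnt_iff)
  ultimately have "openin T U" "closedin T U" "\<one> \<in> U"
    by (auto simp: closedin_def)
  then show ?thesis using open_subgroup_in_clopen[OF compact] U(2) that by (metis order_trans)
qed

text \<open>For \<open>n = 0\<close> the family is empty and its intersection is the whole type;
  \<open>carrier G\<close> keeps the result inside the group. The range starts at 1 to match the
  positive indices in \<open>type_F\<close>.\<close>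

definition open_core :: "nat \<Rightarrow> 'a set" where
  "open_core n = carrier G \<inter>
     \<Inter>{H. subgroup H G \<and> openin T H \<and> card (rcosets H) \<in> {1..n}}"

lemma open_core_subgroup: "subgroup (open_core n) G"
proof -
  have "open_core n =
      \<Inter>(insert (carrier G) {H. subgroup H G \<and> openin T H \<and> card (rcosets H) \<in> {1..n}})"
    by (simp add: open_core_def)
  then show ?thesis
    by (simp only:) (rule subgroups_Inter; use subgroup_self in auto)
qed

lemma open_core_antimono: "m \<le> n \<Longrightarrow> open_core n \<subseteq> open_core m"
  by (fastforce simp: open_core_def)

lemma open_core_invariant:
  assumes h: "h \<in> hom G G" "continuous_map T T h" and x: "x \<in> open_core n"
  shows "h x \<in> open_core n"
proof -
  interpret h: group_hom G G h
    by unfold_locales (rule h(1))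
  have xc: "x \<in> carrier G" using x by (simp add: open_core_def)
  have "h x \<in> H" if H: "subgroup H G" "openin T H" "card (rcosets H) \<in> {1..n}" for H
  proof -
    let ?P = "{x \<in> carrier G. h x \<in> H}"
    have P: "subgroup ?P G" using H(1) h(1) by (rule subgroup_vimage)
    have oP: "openin T ?P"
      using openin_continuous_map_preimage[OF h(2) H(2)] by (simp add: topspace_carrier)
    \<comment> \<open>The preimage is one of its own cosets, so its finite index is positive, as the
      range \<open>{1..n}\<close> demands.\<close>
    have "?P \<in> rcosets ?P"
      using coset_mult_one[of ?P] rcosetsI[of ?P \<one>] by auto
    then have "card (rcosets ?P) > 0"
      using finite_rcosets_open[OF compact P oP] by (auto simp: card_gt_0_iff)
    moreover have "card (rcosets ?P) \<le> n"
      using card_rcosets_vimage_le[OF compact H(1,2) h(1)] H(3) by simp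
    ultimately have "x \<in> ?P" using x P oP by (auto simp: open_core_def)
    then show ?thesis by simp
  qed
  then show ?thesis using xc by (auto simp: open_core_def)
qed

lemma open_core_conj:
  assumes "g \<in> carrier G" "x \<in> open_core n"
  shows "g \<otimes> x \<otimes> inv g \<in> open_core n"
proof (rule open_core_invariant[OF _ continuous_conj[OF assms(1)] assms(2)])
  show "(\<lambda>x. g \<otimes> x \<otimes> inv g) \<in> hom G G"
    using assms(1) by (auto simp: hom_def m_assoc inv_solve_left)
qed

lemma open_core_in_nbhd:
  assumes "openin T W" "\<one> \<in> W"
  obtains n where "open_core n \<subseteq> W"
proof -
  obtain H where H: "subgroup H G" "openin T H" "H \<subseteq> W"
    using open_subgroup_in_nbhd[OF assms] .
  have "H \<in> rcosets H"
    using coset_mult_one[of H] rcosetsI[of H \<one>] subgroup.subset[OF H(1)] by auto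
  then have "card (rcosets H) > 0"
    using finite_rcosets_open[OF compact H(1,2)] by (auto simp: card_gt_0_iff)
  \<comment> \<open>With the index of \<open>H\<close> as bound, \<open>H\<close> is itself a member
    of the intersected family.\<close>
  then have "open_core (card (rcosets H)) \<subseteq> H"
    using H by (auto simp: open_core_def)
  then show ?thesis using H(3) that by blast
qed

lemma open_core_separates:
  assumes x: "x \<in> carrier G" "\<And>n. x \<in> open_core n"
  shows "x = \<one>"
proof (rule ccontr)
  assume "x \<noteq> \<one>"
  then obtain U V where "openin T U" "openin T V" "\<one> \<in> U" "x \<in> V" "disjnt U V"
    using Hausdorff x(1) unfolding Hausdorff_space_def topspace_carrier by (metis one_closed)
  then show False
    using open_core_in_nbhd x(2) by (metis disjnt_iff subsetD)
qed

lemma openin_open_core: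
  assumes "type_F G T"
  shows "openin T (open_core n)"
proof -
  \<comment> \<open>Splitting by the exact index makes each piece finite by type (F). Inserting
    \<open>carrier G\<close> keeps the family nonempty, so that its finite intersection is
    open.\<close>
  define \<F> where "\<F> = insert (carrier G)
    (\<Union>k\<in>{1..n}. {H. subgroup H G \<and> openin T H \<and> card (rcosets H) = k})"
  have "finite \<F>"
    using assms by (auto simp: \<F>_def type_F_def)
  moreover have "openin T U" if "U \<in> \<F>" for U
    using that openin_topspace[of T] by (auto simp: \<F>_def topspace_carrier)
  moreover have "\<F> \<noteq> {}" by (simp add: \<F>_def)
  ultimately have "openin T (\<Inter>\<F>)" by blast
  moreover have "open_core n = \<Inter>\<F>"
    by (auto simp: open_core_def \<F>_def)
  ultimately show ?thesis by simp
qed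

end

section \<open>Iterates of the endomorphism\<close>

locale type_F_endomorphism = profinite_group +
  fixes \<phi> :: "'a \<Rightarrow> 'a"
  assumes type_F: "type_F G T"
    and endo: "continuous_endomorphism G T \<phi>"
begin

lemma hom_funpow: "\<phi> ^^ k \<in> hom G G"
  using endo by (induction k) (auto simp: continuous_endomorphism_def hom_def Pi_iff)

lemma continuous_funpow: "continuous_map T T (\<phi> ^^ k)"
proof (induction k)
  case (Suc k)
  then show ?case
    using endo continuous_map_compose[of T T "\<phi> ^^ k" T \<phi>]
    by (simp add: continuous_endomorphism_def comp_def)
qed (simp add: id_def)

lemma group_hom_funpow: "group_hom G G (\<phi> ^^ k)"
  by unfold_locales (rule hom_funpow)

lemmas funpow_closed [simp] = group_hom.hom_closed[OF group_hom_funpow]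
lemmas funpow_mult = group_hom.hom_mult[OF group_hom_funpow]
lemmas funpow_one [simp] = group_hom.hom_one[OF group_hom_funpow]
lemmas funpow_inv = group_hom.hom_inv[OF group_hom_funpow]

lemma endo_closed [simp]: "x \<in> carrier G \<Longrightarrow> \<phi> x \<in> carrier G"
  using funpow_closed[of x 1] by simp

lemma open_core_funpow: "x \<in> open_core n \<Longrightarrow> (\<phi> ^^ k) x \<in> open_core n"
  by (rule open_core_invariant[OF hom_funpow continuous_funpow])

lemma open_core_funpow_le:
  assumes "(\<phi> ^^ k) x \<in> open_core n" "k \<le> l"
  shows "(\<phi> ^^ l) x \<in> open_core n"
  using open_core_funpow[OF assms(1), of "l - k"] assms(2)
  by (simp flip: funpow_add[THEN fun_cong, unfolded o_apply])

text \<open>Telescoping: \<phi>^p carries the congruence for \<open>k\<close> to one between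
  \<phi>^p(x) and \<phi>^(p(k+1))(x), which is then multiplied by \<open>step\<close>. One return
  thus yields returns at all multiples of \<open>p\<close>.\<close>

lemma iterate_congruent:
  assumes N: "subgroup N G" "\<And>y. y \<in> N \<Longrightarrow> (\<phi> ^^ p) y \<in> N"
    and x: "x \<in> carrier G" and step: "x \<otimes> inv ((\<phi> ^^ p) x) \<in> N"
  shows "x \<otimes> inv ((\<phi> ^^ (p * k)) x) \<in> N"
proof (induction k)
  case 0
  then show ?case using x subgroup.one_closed[OF N(1)] by simp
next
  case (Suc k)
  let ?y = "(\<phi> ^^ p) x" and ?z = "(\<phi> ^^ (p * Suc k)) x"
  have "(\<phi> ^^ p) (x \<otimes> inv ((\<phi> ^^ (p * k)) x)) \<in> N"
    by (rule N(2)[OF Suc])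
  then have "?y \<otimes> inv ?z \<in> N"
    using x by (simp add: funpow_mult funpow_inv funpow_add)
  moreover have "inv ?y \<otimes> (?y \<otimes> inv ?z) = inv ?z"
    using x by (simp add: m_assoc[symmetric])
  ultimately show ?case
    using subgroup.m_closed[OF N(1) step, of "?y \<otimes> inv ?z"] x by (simp add: m_assoc)
qed

section \<open>The basins and the contraction subgroup\<close>

definition basin :: "nat \<Rightarrow> 'a set" where
  "basin n = {x \<in> carrier G. \<exists>k. (\<phi> ^^ k) x \<in> open_core n}"

text \<open>One direction only shifts the exponent; the other uses that an orbit never leaves an
  open core it has entered.\<close>

lemma basin_funpow_iff:
  assumes "x \<in> carrier G"
  shows "(\<phi> ^^ k) x \<in> basin n \<longleftrightarrow> x \<in> basin n"
proof
  assume "(\<phi> ^^ k) x \<in> basin n"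
  then obtain l where "(\<phi> ^^ (l + k)) x \<in> open_core n"
    by (auto simp: basin_def funpow_add)
  then show "x \<in> basin n" using assms by (auto simp: basin_def)
next
  assume "x \<in> basin n"
  then obtain l where "(\<phi> ^^ l) x \<in> open_core n" by (auto simp: basin_def)
  then have "(\<phi> ^^ (l + k)) x \<in> open_core n" by (rule open_core_funpow_le) simp
  then show "(\<phi> ^^ k) x \<in> basin n" using assms by (auto simp: basin_def funpow_add)
qed

lemma basin_antimono: "m \<le> n \<Longrightarrow> basin n \<subseteq> basin m"
  using open_core_antimono[of m n] by (auto simp: basin_def)

lemma basin_subgroup: "subgroup (basin n) G"
proof (rule subgroupI)
  have one: "\<one> \<in> open_core n" using subgroup.one_closed[OF open_core_subgroup] .
  then have "\<one> \<in> basin n" by (simp add: basin_def)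
  then show "basin n \<noteq> {}" by blast
  show "basin n \<subseteq> carrier G" by (auto simp: basin_def)
  show "inv a \<in> basin n" if "a \<in> basin n" for a
    using that subgroup.m_inv_closed[OF open_core_subgroup] by (auto simp: basin_def funpow_inv)
  show "a \<otimes> b \<in> basin n" if a: "a \<in> basin n" and b: "b \<in> basin n" for a b
  proof -
    obtain k l where "(\<phi> ^^ k) a \<in> open_core n" "(\<phi> ^^ l) b \<in> open_core n"
      using a b by (auto simp: basin_def)
    \<comment> \<open>The two entry times may differ; by time \<open>k + l\<close> both orbits are
      in the core.\<close>
    then have "(\<phi> ^^ (k + l)) a \<in> open_core n" "(\<phi> ^^ (k + l)) b \<in> open_core n"
      by (metis open_core_funpow_le le_add1, metis open_core_funpow_le le_add2)
    moreover have "a \<in> carrier G" "b \<in> carrier G" using a b by (auto simp: basin_def)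
    ultimately show ?thesis
      using subgroup.m_closed[OF open_core_subgroup]
      by (auto simp: basin_def funpow_mult intro!: exI[of _ "k + l"])
  qed
qed

lemma basin_conj:
  assumes "g \<in> carrier G" "x \<in> basin n"
  shows "g \<otimes> x \<otimes> inv g \<in> basin n"
proof -
  obtain k where x: "x \<in> carrier G" and k: "(\<phi> ^^ k) x \<in> open_core n"
    using assms(2) by (auto simp: basin_def)
  have "(\<phi> ^^ k) (g \<otimes> x \<otimes> inv g) \<in> open_core n"
    using open_core_conj[OF _ k, of "(\<phi> ^^ k) g"] assms(1) x by (simp add: funpow_mult funpow_inv)
  then show ?thesis using assms(1) x by (auto simp: basin_def)
qed

lemma openin_basin: "openin T (basin n)"
proof -
  have "basin n = (\<Union>k. {x \<in> topspace T. (\<phi> ^^ k) x \<in> open_core n})"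
    by (auto simp: basin_def topspace_carrier)
  moreover have "openin T {x \<in> topspace T. (\<phi> ^^ k) x \<in> open_core n}" for k
    by (rule openin_continuous_map_preimage[OF continuous_funpow openin_open_core[OF type_F]])
  ultimately show ?thesis by auto
qed

text \<open>Since an orbit stays in every open core it enters, entering each core once already
  amounts to convergence to \<open>\<one>\<close>.\<close>

lemma Con_eq: "Con G T \<phi> = (\<Inter>n. basin n)"
proof (intro equalityI subsetI)
  fix x assume x: "x \<in> Con G T \<phi>"
  have "x \<in> basin n" for n
  proof -
    have "\<forall>\<^sub>F k in sequentially. (\<phi> ^^ k) x \<in> open_core n"
      using x openin_open_core[OF type_F] subgroup.one_closed[OF open_core_subgroup]
      by (auto simp: Con_def limitin_def)
    then obtain k where "(\<phi> ^^ k) x \<in> open_core n"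
      by (auto simp: eventually_sequentially)
    then show ?thesis using x by (auto simp: basin_def Con_def)
  qed
  then show "x \<in> (\<Inter>n. basin n)" by blast
next
  fix x assume x: "x \<in> (\<Inter>n. basin n)"
  have "\<forall>\<^sub>F k in sequentially. (\<phi> ^^ k) x \<in> U" if U: "openin T U" "\<one> \<in> U" for U
  proof -
    obtain n where n: "open_core n \<subseteq> U" using open_core_in_nbhd[OF U] .
    obtain k where "(\<phi> ^^ k) x \<in> open_core n" using x by (auto simp: basin_def)
    then have "\<forall>l\<ge>k. (\<phi> ^^ l) x \<in> U" using open_core_funpow_le n by blast
    then show ?thesis by (auto simp: eventually_sequentially)
  qed
  then show "x \<in> Con G T \<phi>"
    using x by (auto simp: Con_def limitin_def topspace_carrier basin_def)
qed

lemma Con_normal: "Con G T \<phi> \<lhd> G"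
proof -
  have "subgroup (Con G T \<phi>) G"
    unfolding Con_eq by (rule subgroups_Inter) (use basin_subgroup in auto)
  then show ?thesis
    unfolding normal_inv_iff using basin_conj by (auto simp: Con_eq)
qed

lemma Con_closedin: "closedin T (Con G T \<phi>)"
  unfolding Con_eq
  using open_subgroup_closedin[OF basin_subgroup openin_basin] by (intro closedin_Inter) auto

lemma Con_funpow_iff: "x \<in> carrier G \<Longrightarrow> (\<phi> ^^ k) x \<in> Con G T \<phi> \<longleftrightarrow> x \<in> Con G T \<phi>"
  by (simp add: Con_eq basin_funpow_iff)

section \<open>The stable image \<phi>_+(G)\<close>

lemma closedin_funpow_image: "closedin T ((\<phi> ^^ n) ` carrier G)"
  using image_compactin[of T "carrier G" T "\<phi> ^^ n"] continuous_funpow compact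
    compactin_imp_closedin[OF Hausdorff]
  by (simp add: compact_space_def topspace_carrier)

lemma funpow_image_antimono:
  assumes "m \<le> n"
  shows "(\<phi> ^^ n) ` carrier G \<subseteq> (\<phi> ^^ m) ` carrier G"
proof -
  have "(\<phi> ^^ n) x = (\<phi> ^^ m) ((\<phi> ^^ (n - m)) x)" for x
    using assms by (simp flip: funpow_add[THEN fun_cong, unfolded o_apply])
  then show ?thesis by auto
qed

lemma phi_plus_subgroup: "subgroup (phi_plus G \<phi>) G"
proof -
  have "subgroup ((\<phi> ^^ n) ` carrier G) G" for n
    by (rule group_hom.img_is_subgroup[OF group_hom_funpow])
  then show ?thesis
    unfolding phi_plus_def by (intro subgroups_Inter) auto
qed

lemma phi_plus_closedin: "closedin T (phi_plus G \<phi>)"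
  unfolding phi_plus_def using closedin_funpow_image by (intro closedin_Inter) auto

lemma phi_plus_image: "\<phi> ` phi_plus G \<phi> = phi_plus G \<phi>"
proof (intro equalityI subsetI)
  fix y assume "y \<in> \<phi> ` phi_plus G \<phi>"
  then obtain x where x: "x \<in> phi_plus G \<phi>" "y = \<phi> x" by blast
  have "y \<in> (\<phi> ^^ n) ` carrier G" for n
  proof -
    obtain z where "z \<in> carrier G" "x = (\<phi> ^^ n) z" using x(1) by (auto simp: phi_plus_def)
    then show ?thesis using x(2) by (auto simp: funpow_swap1 intro!: image_eqI[of _ _ "\<phi> z"])
  qed
  then show "y \<in> phi_plus G \<phi>" by (auto simp: phi_plus_def)
next
  fix y assume y: "y \<in> phi_plus G \<phi>"
  have yc: "y \<in> carrier G" using y phi_plus_subgroup subgroup.mem_carrier by metis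
  \<comment> \<open>A preimage of \<open>y\<close> in \<phi>_+(G) is a point of the fibre over
    \<open>y\<close> lying in every \<phi>^n(G). The sets \<open>?C n\<close> are closed, nonempty
    and nested, so compactness supplies one.\<close>
  let ?C = "\<lambda>n. (\<phi> ^^ n) ` carrier G \<inter> {x \<in> topspace T. \<phi> x \<in> {y}}"
  have "(\<Inter>n. ?C n) \<noteq> {}"
  proof (rule compact_space_imp_nest[OF compact])
    show "closedin T (?C n)" for n
    proof -
      have "closedin T {y}"
        using yc Hausdorff by (simp add: closedin_Hausdorff_singleton topspace_carrier)
      moreover have "continuous_map T T \<phi>"
        using endo by (simp add: continuous_endomorphism_def)
      ultimately show ?thesis
        using closedin_funpow_image closedin_continuous_map_preimage by blast
    qed
    show "?C n \<noteq> {}" for n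
    proof -
      \<comment> \<open>The extra iterate is the one that leads from \<phi>^n(z) to
        \<open>y\<close>.\<close>
      obtain z where "z \<in> carrier G" "y = (\<phi> ^^ Suc n) z" using y unfolding phi_plus_def by blast
      then have "(\<phi> ^^ n) z \<in> ?C n" by (simp add: topspace_carrier)
      then show ?thesis by blast
    qed
    show "decseq ?C" unfolding decseq_def using funpow_image_antimono by blast
  qed
  then obtain x where "\<And>n. x \<in> ?C n" by blast
  then have "x \<in> phi_plus G \<phi>" "\<phi> x = y" unfolding phi_plus_def by blast+
  then show "y \<in> \<phi> ` phi_plus G \<phi>" by blast
qed

section \<open>The semidirect decomposition\<close>

lemma Con_Int_phi_plus: "Con G T \<phi> \<inter> phi_plus G \<phi> = {\<one>}"
proof -
  have "x = \<one>" if xC: "x \<in> Con G T \<phi>" and xP: "x \<in> phi_plus G \<phi>" for x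
  proof (rule open_core_separates)
    show xc: "x \<in> carrier G" using xC by (simp add: Con_def)
    fix n
    have "\<forall>j. \<exists>y. y \<in> carrier G \<and> (\<phi> ^^ j) y = x" using xP by (auto simp: phi_plus_def)
    \<comment> \<open>The preimages \<open>y j\<close> are chosen independently for each
      \<open>j\<close>; they need not form a single backward orbit.\<close>
    then obtain y where y: "\<And>j. y j \<in> carrier G" "\<And>j. (\<phi> ^^ j) (y j) = x" by metis
    obtain i j where ij: "i < j" and M: "y i \<otimes> inv (y j) \<in> open_core n"
      using open_subgroup_recurrence[OF compact open_core_subgroup openin_open_core[OF type_F] y(1)] .
    define p where "p = j - i"
    \<comment> \<open>Applying \<phi>^j to the congruence of \<open>y i\<close> and
      \<open>y j\<close> turns \<open>y j\<close> into \<open>x\<close> and \<open>y i\<close> into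
      \<phi>^p(x), as \<phi>^i(y i) is already \<open>x\<close>.\<close>
    have "(\<phi> ^^ j) (y i) = (\<phi> ^^ p) x"
      using ij y(2)[of i] funpow_add[of p i \<phi>] by (simp add: p_def)
    then have "(\<phi> ^^ p) x \<otimes> inv x \<in> open_core n"
      using open_core_funpow[OF M, of j] y by (simp add: funpow_mult funpow_inv)
    from subgroup.m_inv_closed[OF open_core_subgroup this]
    have step: "x \<otimes> inv ((\<phi> ^^ p) x) \<in> open_core n"
      using xc by (simp add: inv_mult_group)
    have iter: "x \<otimes> inv ((\<phi> ^^ (p * k)) x) \<in> open_core n" for k
      by (rule iterate_congruent[OF open_core_subgroup open_core_funpow xc step])
    obtain k where "(\<phi> ^^ k) x \<in> open_core n" using xC by (auto simp: Con_eq basin_def)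
    \<comment> \<open>As \<open>p\<close> is at least 1, the time \<open>p * k\<close> is late
      enough for the orbit to be in the core, and it is also a return time of
      \<open>x\<close>.\<close>
    moreover have "k \<le> p * k" using ij by (simp add: p_def Suc_le_eq)
    ultimately have "(\<phi> ^^ (p * k)) x \<in> open_core n" by (rule open_core_funpow_le)
    from subgroup.m_closed[OF open_core_subgroup iter[of k] this]
    show "x \<in> open_core n" using xc by (simp add: m_assoc)
  qed
  moreover have "\<one> \<in> Con G T \<phi>" "\<one> \<in> phi_plus G \<phi>"
    using subgroup.one_closed normal_imp_subgroup[OF Con_normal] phi_plus_subgroup by metis+
  ultimately show ?thesis by blast
qed

lemma basin_funpow_representative:
  assumes g: "g \<in> carrier G"
  obtains h where "h \<in> (\<phi> ^^ m) ` carrier G" "g \<otimes> inv h \<in> basin n"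
proof -
  obtain i j where ij: "i < j" and B: "(\<phi> ^^ i) g \<otimes> inv ((\<phi> ^^ j) g) \<in> basin n"
    using open_subgroup_recurrence[OF compact basin_subgroup openin_basin, of "\<lambda>i. (\<phi> ^^ i) g"] g
    by auto
  define p where "p = j - i"
  have "(\<phi> ^^ i) (g \<otimes> inv ((\<phi> ^^ p) g)) \<in> basin n"
    using B g ij funpow_add[of i p \<phi>] by (simp add: p_def funpow_mult funpow_inv)
  \<comment> \<open>The basin is its own preimage under \<phi>^i, so \<phi>^i can be
    cancelled.\<close>
  then have step: "g \<otimes> inv ((\<phi> ^^ p) g) \<in> basin n"
    using g by (simp add: basin_funpow_iff)
  have iter: "g \<otimes> inv ((\<phi> ^^ (p * k)) g) \<in> basin n" for k
    by (rule iterate_congruent[OF basin_subgroup _ g step])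
      (use basin_funpow_iff subgroup.mem_carrier[OF basin_subgroup] in blast)
  have "(\<phi> ^^ (p * m)) g \<in> (\<phi> ^^ (p * m)) ` carrier G" using g by blast
  moreover have "m \<le> p * m" using ij by (simp add: p_def Suc_le_eq)
  ultimately have "(\<phi> ^^ (p * m)) g \<in> (\<phi> ^^ m) ` carrier G"
    using funpow_image_antimono by blast
  then show ?thesis using iter that by blast
qed

lemma Con_mult_phi_plus: "Con G T \<phi> <#> phi_plus G \<phi> = carrier G"
proof (intro equalityI subsetI)
  fix g assume "g \<in> Con G T \<phi> <#> phi_plus G \<phi>"
  then show "g \<in> carrier G"
    using subgroup.mem_carrier[OF phi_plus_subgroup] by (auto simp: set_mult_def Con_def)
next
  fix g assume g: "g \<in> carrier G"
  \<comment> \<open>A point common to all \<open>?C n\<close> lies in \<phi>_+(G) and differs from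
    \<open>g\<close> by an element of every basin, hence of Con(\<phi>). Both conditions tighten as
    \<open>n\<close> grows, so compactness applies.\<close>
  let ?C = "\<lambda>n. (\<phi> ^^ n) ` carrier G \<inter> {h \<in> topspace T. g \<otimes> inv h \<in> basin n}"
  have "(\<Inter>n. ?C n) \<noteq> {}"
  proof (rule compact_space_imp_nest[OF compact])
    have "continuous_map T T (\<lambda>h. g \<otimes> inv h)"
      using g continuous_inv by (intro continuous_mult_compose) (auto simp: topspace_carrier)
    then show "closedin T (?C n)" for n
      using closedin_funpow_image open_subgroup_closedin[OF basin_subgroup openin_basin]
        closedin_continuous_map_preimage by blast
    show "?C n \<noteq> {}" for n
    proof -
      obtain h where h: "h \<in> (\<phi> ^^ n) ` carrier G" "g \<otimes> inv h \<in> basin n"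
        using basin_funpow_representative[OF g] .
      then have "h \<in> ?C n" by (auto simp: topspace_carrier)
      then show ?thesis by blast
    qed
    show "decseq ?C"
      unfolding decseq_def using funpow_image_antimono basin_antimono by blast
  qed
  then obtain h where h: "\<And>n. h \<in> ?C n" by blast
  then have "h \<in> phi_plus G \<phi>" "g \<otimes> inv h \<in> Con G T \<phi>"
    unfolding phi_plus_def Con_eq by blast+
  moreover have "g = (g \<otimes> inv h) \<otimes> h"
    using g h[of 0] by (simp add: m_assoc topspace_carrier)
  ultimately show "g \<in> Con G T \<phi> <#> phi_plus G \<phi>"
    unfolding set_mult_def by blast
qed

section \<open>The automorphism of \<phi>_+(G) and the images of Con(\<phi>)\<close>

lemma phi_plus_inj: "inj_on \<phi> (phi_plus G \<phi>)"
proof (rule inj_onI)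
  fix x y assume xy: "x \<in> phi_plus G \<phi>" "y \<in> phi_plus G \<phi>" "\<phi> x = \<phi> y"
  have c: "x \<in> carrier G" "y \<in> carrier G"
    using xy subgroup.mem_carrier[OF phi_plus_subgroup] by auto
  \<comment> \<open>An element of the kernel lies in Con(\<phi>), so the trivial intersection with
    \<phi>_+(G) gives injectivity. The exponent 1 makes the lemmas on iterates applicable.\<close>
  have "(\<phi> ^^ 1) (x \<otimes> inv y) = \<one>"
    unfolding funpow_mult[OF c(1) inv_closed[OF c(2)]] funpow_inv[OF c(2)]
    using xy(3) c by simp
  then have "(\<phi> ^^ 1) (x \<otimes> inv y) \<in> Con G T \<phi>"
    using Con_Int_phi_plus by auto
  then have "x \<otimes> inv y \<in> Con G T \<phi>"
    using c by (subst (asm) Con_funpow_iff) auto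
  moreover have "x \<otimes> inv y \<in> phi_plus G \<phi>"
    using xy phi_plus_subgroup by (simp add: subgroup.m_closed subgroup.m_inv_closed)
  ultimately have "x \<otimes> inv y = \<one>" using Con_Int_phi_plus by blast
  then show "x = y" using c by (metis inv_equality inv_inv inv_closed)
qed

text \<open>Continuity of the inverse comes from compactness: \<phi>_+(G) is closed in
  \<open>G\<close>, and a continuous bijection of a compact Hausdorff space is a closed map.\<close>

lemma phi_plus_automorphism: "restricts_to_automorphism G T \<phi> (phi_plus G \<phi>)"
proof -
  let ?P = "phi_plus G \<phi>"
  have sub: "?P \<subseteq> carrier G" using subgroup.subset[OF phi_plus_subgroup] .
  have "\<phi> \<in> iso (G\<lparr>carrier := ?P\<rparr>) (G\<lparr>carrier := ?P\<rparr>)"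
    using endo phi_plus_image phi_plus_inj sub
    by (auto simp: iso_def hom_def bij_betw_def continuous_endomorphism_def subset_iff)
  moreover have "homeomorphic_map (subtopology T ?P) (subtopology T ?P) \<phi>"
  proof (rule bijective_closed_imp_homeomorphic_map)
    show cont: "continuous_map (subtopology T ?P) (subtopology T ?P) \<phi>"
      using endo phi_plus_image
      by (auto simp: continuous_endomorphism_def continuous_map_in_subtopology
          continuous_map_from_subtopology)
    show "closed_map (subtopology T ?P) (subtopology T ?P) \<phi>"
    proof (rule continuous_imp_closed_map_gen[OF _ _ cont])
      show "compact_space (subtopology T ?P)"
        by (simp add: closedin_compact_space compact compact_space_subtopology phi_plus_closedin)
      show "kc_space (subtopology T ?P)"
        by (simp add: Hausdorff Hausdorff_imp_kc_space Hausdorff_space_subtopology)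
    qed
    have "topspace (subtopology T ?P) = ?P" using sub by (auto simp: topspace_carrier)
    then show "\<phi> ` topspace (subtopology T ?P) = topspace (subtopology T ?P)"
      "inj_on \<phi> (topspace (subtopology T ?P))"
      using phi_plus_image phi_plus_inj by simp_all
  qed
  ultimately show ?thesis by (simp add: restricts_to_automorphism_def)
qed

text \<open>Con(\<phi>) is its own preimage under \<phi>^k, so whenever \<phi>^k(x) lies in it,
  \<open>x\<close> does too.\<close>

lemma Con_funpow_image: "(\<phi> ^^ k) ` Con G T \<phi> = Con G T \<phi> \<inter> (\<phi> ^^ k) ` carrier G"
proof -
  have "Con G T \<phi> \<subseteq> carrier G" by (auto simp: Con_def)
  then show ?thesis using Con_funpow_iff by blast
qed

end

theorem theoremA:
  fixes G :: "('a, 'b) monoid_scheme" and T :: "'a topology" and \<phi> :: "'a \<Rightarrow> 'a"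
  assumes "profinite_group G T"
    and "type_F G T"
    and "continuous_endomorphism G T \<phi>"
  shows "subgroup (Con G T \<phi>) G \<and> closedin T (Con G T \<phi>) \<and>
         subgroup (phi_plus G \<phi>) G \<and> closedin T (phi_plus G \<phi>) \<and>
         internal_semidirect_product G (Con G T \<phi>) (phi_plus G \<phi>) \<and>
         restricts_to_automorphism G T \<phi> (phi_plus G \<phi>) \<and>
         (\<forall>k::nat. (\<phi> ^^ k) ` Con G T \<phi> = Con G T \<phi> \<inter> (\<phi> ^^ k) ` carrier G)"
proof -
  interpret profinite_group G T by (fact assms(1))
  interpret type_F_endomorphism G T \<phi>
    by unfold_locales (fact assms(2), fact assms(3))
  have "subgroup (Con G T \<phi>) G"
    using Con_normal by (rule normal_imp_subgroup)
  moreover have "internal_semidirect_product G (Con G T \<phi>) (phi_plus G \<phi>)"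
    unfolding internal_semidirect_product_def
    using Con_normal phi_plus_subgroup Con_Int_phi_plus Con_mult_phi_plus by blast
  ultimately show ?thesis
    using Con_closedin phi_plus_subgroup phi_plus_closedin phi_plus_automorphism Con_funpow_image
    by blast
qed

end
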